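(* Let $\mathbb{C}=(\mathfrak{C},\mu,\eta)$ be the completion monad on $\mathbf{QUnif}$ and $(R,r)$ the separation epireflector of $\mathbf{QUnif}$ onto $\mathbf{QUnif}_0$. Then $R\eta$ is an epimorphism in $\mathbf{QUnif}_0$ (i.e. $R\eta_X:RX\to R\mathfrak{C}X$ is an epimorphism in $\mathbf{QUnif}_0$ for each quasi-uniform space $X$), and $R\mathfrak{C}(X,\mathcal{U})$ is a separated complete quasi-uniform space for each quasi-uniform space $(X,\mathcal{U})$.
   Context: $\mathbf{QUnif}$ is the category of quasi-uniform spaces and quasi-uniformly continuous maps. For a quasi-uniform space $(X,\mathcal{U})$, let $\mathcal{U}\vee\mathcal{U}^{-1}$ be the coarsest uniformity containing $\mathcal{U}$. A (proper) filter $\mathcal{F}$ on $X$ is Cauchy if for every $U\in\mathcal{U}$ there is $A\in\mathcal{F}$ with $A\times A\subseteq U$. $(X,\mathcal{U})$ is complete if every Cauchy filter converges in the topology of $\mathcal{U}\vee\mathcal{U}^{-1}$, and separated if the topology of $\mathcal{U}\vee\mathcal{U}^{-1}$ is Hausdorff (equivalently, the topology induced by $\mathcal{U}$ is $T_0$). $\mathbf{QUnif}_0$ is the full subcategory of separated quasi-uniform spaces; $R$ is the left adjoint of its inclusion (viewed as an endofunctor of $\mathbf{QUnif}$), with unit $r$. Completion monad $\mathbb{C}=(\mathfrak{C},\mu,\eta)$: $\mathfrak{C}X$ is the set of all Cauchy filters on $(X,\mathcal{U})$, with the quasi-uniformity $\mathcal{U}^*$ having as a basis $\{U^*\mid U\in\mathcal{U}\}$,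 where $(\mathcal{F},\mathcal{G})\in U^*$ iff there are $A\in\mathcal{F}$, $B\in\mathcal{G}$ with $A\times B\subseteq U$. For quasi-uniformly continuous $f$, $\mathfrak{C}f(\mathcal{F})$ has as a basis $\{G\mid f^{-1}(G)\in\mathcal{F}\}$. $\mu_X(\mathfrak{X})=\{G\mid G^*\in\mathfrak{X}\}$ with $G^*=\{\mathcal{F}\in\mathfrak{C}X\mid G\in\mathcal{F}\}$, and $\eta_X(x)=\{A\subseteq X\mid x\in A\}$. *)

theory Defs
  imports "HOL-Analysis.Analysis"
begin

section \<open>Quasi-uniform spaces\<close>

text \<open>
  The quasi-uniformity of a space with point set \<open>pts X\<close> is stored, like the library's
  \<^const>\<open>uniformity\<close>, as a filter \<open>ents X\<close> of relations. Filters on a set \<open>A\<close> are rendered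
  throughout as library filters \<open>F\<close> with \<open>F \<le> principal A\<close>; such an \<open>F\<close> is determined by
  its members contained in \<open>A\<close>.
\<close>

record 'a qus =
  pts :: "'a set"
  ents :: "('a \<times> 'a) filter"

definition mem :: "'a set \<Rightarrow> 'a filter \<Rightarrow> bool" where
  "mem A F \<longleftrightarrow> eventually (\<lambda>x. x \<in> A) F"

definition qunif :: "'a qus \<Rightarrow> bool" where
  "qunif X \<longleftrightarrow> mem (pts X \<times> pts X) (ents X)
     \<and> (\<forall>U. mem U (ents X) \<longrightarrow> (\<forall>x \<in> pts X. (x, x) \<in> U))
     \<and> (\<forall>U. mem U (ents X) \<longrightarrow> (\<exists>V. mem V (ents X) \<and> V O V \<subseteq> U))"

definition qumap :: "'a qus \<Rightarrow> 'b qus \<Rightarrow> ('a \<Rightarrow> 'b) \<Rightarrow> bool" where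
  "qumap X Y f \<longleftrightarrow> f \<in> pts X \<rightarrow> pts Y \<and> filterlim (map_prod f f) (ents Y) (ents X)"

text \<open>
  \<open>qtop\<close> is only applied to symmetrized spaces, so the orientation of the neighbourhoods
  is immaterial.
\<close>

definition qtop :: "'a qus \<Rightarrow> 'a topology" where
  "qtop X = topology (\<lambda>G. G \<subseteq> pts X \<and>
     (\<forall>x \<in> G. \<exists>U. mem U (ents X) \<and> {y \<in> pts X. (x, y) \<in> U} \<subseteq> G))"

text \<open>
  The space carrying the join of the quasi-uniformity and its inverse. The order on library
  filters is the reverse of inclusion, so the join is the infimum.
\<close>

definition qsym :: "'a qus \<Rightarrow> 'a qus" where
  "qsym X = \<lparr>pts = pts X, ents = inf (ents X) (filtermap prod.swap (ents X))\<rparr>"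

definition cauchy_on :: "'a qus \<Rightarrow> 'a filter \<Rightarrow> bool" where
  "cauchy_on X F \<longleftrightarrow> F \<noteq> bot \<and> mem (pts X) F
     \<and> (\<forall>U. mem U (ents X) \<longrightarrow> (\<exists>A. mem A F \<and> A \<times> A \<subseteq> U))"

definition complete_qus :: "'a qus \<Rightarrow> bool" where
  "complete_qus X \<longleftrightarrow> (\<forall>F. cauchy_on X F \<longrightarrow> (\<exists>x. limitin (qtop (qsym X)) (\<lambda>y. y) x F))"

definition separated_qus :: "'a qus \<Rightarrow> bool" where
  "separated_qus X \<longleftrightarrow> Hausdorff_space (qtop (qsym X))"

text \<open>
  Epimorphisms of the full subcategory of separated spaces. HOL cannot quantify over types inside
  a formula, so the type of the test spaces is a parameter; a theorem about
  \<open>epi_qunif0 TYPE('c)\<close> with \<open>'c\<close> a type variable covers test spaces over all types.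
\<close>

definition epi_qunif0 :: "'c itself \<Rightarrow> 'a qus \<Rightarrow> 'b qus \<Rightarrow> ('a \<Rightarrow> 'b) \<Rightarrow> bool" where
  "epi_qunif0 _ X Y f \<longleftrightarrow>
     qunif X \<and> separated_qus X \<and> qunif Y \<and> separated_qus Y \<and> qumap X Y f \<and>
     (\<forall>(Z :: 'c qus) g h. qunif Z \<and> separated_qus Z \<and> qumap Y Z g \<and> qumap Y Z h \<and>
        (\<forall>x \<in> pts X. g (f x) = h (f x)) \<longrightarrow> (\<forall>y \<in> pts Y. g y = h y))"


section \<open>The completion monad\<close>

definition star :: "'a qus \<Rightarrow> ('a \<times> 'a) set \<Rightarrow> ('a filter \<times> 'a filter) set" where
  "star X U = {(F, G). cauchy_on X F \<and> cauchy_on X G \<and>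
     (\<exists>A B. mem A F \<and> mem B G \<and> A \<times> B \<subseteq> U)}"

definition compl :: "'a qus \<Rightarrow> 'a filter qus" where
  "compl X = \<lparr>pts = {F. cauchy_on X F},
     ents = (INF U \<in> {U. mem U (ents X)}. principal (star X U))\<rparr>"

definition compl_map :: "('a \<Rightarrow> 'b) \<Rightarrow> 'a filter \<Rightarrow> 'b filter" where
  "compl_map f = filtermap f"

definition compl_unit :: "'a \<Rightarrow> 'a filter" where
  "compl_unit x = principal {x}"

definition compl_mult :: "'a filter filter \<Rightarrow> 'a filter" where
  "compl_mult XX = Abs_filter (\<lambda>P. eventually (\<lambda>F. eventually P F) XX)"


section \<open>The separation reflector\<close>

text \<open>
  The reflector is the quotient by the intersection of all entourages and their inverses, with the
  final quasi-uniformity. That it is left adjoint to the inclusion of the separated spaces, with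
  unit \<open>sep_unit\<close>, is proved in \<open>sep_universal\<close> below; \<open>sep_map_unique\<close> shows that
  \<open>sep_map\<close> is the induced action on morphisms.
\<close>

definition sep_rel :: "'a qus \<Rightarrow> ('a \<times> 'a) set" where
  "sep_rel X = {(x, y). x \<in> pts X \<and> y \<in> pts X \<and>
     (\<forall>U. mem U (ents X) \<longrightarrow> (x, y) \<in> U \<and> (y, x) \<in> U)}"

definition sep_unit :: "'a qus \<Rightarrow> 'a \<Rightarrow> 'a set" where
  "sep_unit X x = sep_rel X `` {x}"

definition sep :: "'a qus \<Rightarrow> 'a set qus" where
  "sep X = \<lparr>pts = pts X // sep_rel X,
     ents = filtermap (map_prod (sep_unit X) (sep_unit X)) (ents X)\<rparr>"

definition sep_map :: "'b qus \<Rightarrow> ('a \<Rightarrow> 'b) \<Rightarrow> 'a set \<Rightarrow> 'b set" where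
  "sep_map Y f c = the_elem ((\<lambda>x. sep_unit Y (f x)) ` c)"


section \<open>Basic facts\<close>

lemma mem_mono: "mem A F \<Longrightarrow> A \<subseteq> B \<Longrightarrow> mem B F"
  unfolding mem_def by (erule eventually_mono) auto

lemma mem_Int: "mem A F \<Longrightarrow> mem B F \<Longrightarrow> mem (A \<inter> B) F"
  unfolding mem_def by (simp add: eventually_conj)

lemma mem_nonempty: "mem A F \<Longrightarrow> F \<noteq> bot \<Longrightarrow> A \<noteq> {}"
  unfolding mem_def by auto

lemma mem_iff_principal: "mem A F \<longleftrightarrow> F \<le> principal A"
  by (simp add: mem_def le_principal)

lemma mem_filtermap: "mem A (filtermap f F) \<longleftrightarrow> mem (f -` A) F"
  by (simp add: mem_def eventually_filtermap)

lemma qumap_iff: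
  "qumap X Y f \<longleftrightarrow> f \<in> pts X \<rightarrow> pts Y \<and>
     (\<forall>V. mem V (ents Y) \<longrightarrow> mem {(x, y). (f x, f y) \<in> V} (ents X))"
proof -
  have "filterlim (map_prod f f) (ents Y) (ents X) \<longleftrightarrow>
        (\<forall>V. mem V (ents Y) \<longrightarrow> mem {(x, y). (f x, f y) \<in> V} (ents X))"
  proof
    assume "filterlim (map_prod f f) (ents Y) (ents X)"
    then show "\<forall>V. mem V (ents Y) \<longrightarrow> mem {(x, y). (f x, f y) \<in> V} (ents X)"
      by (auto simp: filterlim_iff mem_def case_prod_unfold map_prod_def)
  next
    assume *: "\<forall>V. mem V (ents Y) \<longrightarrow> mem {(x, y). (f x, f y) \<in> V} (ents X)"
    show "filterlim (map_prod f f) (ents Y) (ents X)"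
      unfolding filterlim_iff
    proof (intro allI impI)
      fix P assume "eventually P (ents Y)"
      then show "eventually (\<lambda>x. P (map_prod f f x)) (ents X)"
        using *[rule_format, of "Collect P"]
        by (simp add: mem_def case_prod_unfold map_prod_def)
    qed
  qed
  then show ?thesis by (simp add: qumap_def)
qed

lemma openin_qtop:
  "openin (qtop X) G \<longleftrightarrow> G \<subseteq> pts X \<and>
     (\<forall>x \<in> G. \<exists>U. mem U (ents X) \<and> {y \<in> pts X. (x, y) \<in> U} \<subseteq> G)"
proof -
  let ?P = "\<lambda>G. G \<subseteq> pts X \<and> (\<forall>x \<in> G. \<exists>U. mem U (ents X) \<and> {y \<in> pts X. (x, y) \<in> U} \<subseteq> G)"
  have "?P (S \<inter> T)" if S: "?P S" and T: "?P T" for S T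
  proof (intro conjI ballI)
    show "S \<inter> T \<subseteq> pts X" using S by auto
    fix x assume "x \<in> S \<inter> T"
    then obtain U V where "mem U (ents X)" "{y \<in> pts X. (x, y) \<in> U} \<subseteq> S"
        "mem V (ents X)" "{y \<in> pts X. (x, y) \<in> V} \<subseteq> T"
      using S T by blast
    then show "\<exists>U. mem U (ents X) \<and> {y \<in> pts X. (x, y) \<in> U} \<subseteq> S \<inter> T"
      by (intro exI[of _ "U \<inter> V"]) (auto intro: mem_Int)
  qed
  moreover have "?P (\<Union>K)" if "\<forall>k\<in>K. ?P k" for K
  proof (intro conjI ballI)
    show "\<Union>K \<subseteq> pts X" using that by auto
    fix x assume "x \<in> \<Union>K"
    then obtain k where k: "k \<in> K" "x \<in> k" by auto
    have "?P k" using that k(1) by (rule bspec)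
    with k(2) obtain U where "mem U (ents X)" "{y \<in> pts X. (x, y) \<in> U} \<subseteq> k"
      by blast
    then show "\<exists>U. mem U (ents X) \<and> {y \<in> pts X. (x, y) \<in> U} \<subseteq> \<Union>K"
      using k by (intro exI[of _ U]) auto
  qed
  ultimately have "istopology ?P"
    unfolding istopology_def by blast
  then show ?thesis
    unfolding qtop_def by simp
qed

lemma topspace_qtop [simp]: "topspace (qtop X) = pts X"
proof -
  have "mem UNIV (ents X)" by (simp add: mem_def)
  then have "openin (qtop X) (pts X)" unfolding openin_qtop by blast
  moreover have "openin (qtop X) G \<Longrightarrow> G \<subseteq> pts X" for G by (simp add: openin_qtop)
  ultimately show ?thesis unfolding topspace_def by blast
qed

lemma mem_qsym:
  "mem U (ents (qsym X)) \<longleftrightarrow> (\<exists>V. mem V (ents X) \<and> V \<inter> V\<inverse> \<subseteq> U)"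
proof
  assume "mem U (ents (qsym X))"
  then obtain Q R where "eventually Q (ents X)" "eventually (\<lambda>p. R (prod.swap p)) (ents X)"
      and QR: "\<forall>p. Q p \<and> R p \<longrightarrow> p \<in> U"
    unfolding mem_def qsym_def by (auto simp: eventually_inf eventually_filtermap)
  then have "mem {p. Q p \<and> R (prod.swap p)} (ents X)"
    by (simp add: mem_def eventually_conj)
  moreover have "{p. Q p \<and> R (prod.swap p)} \<inter> {p. Q p \<and> R (prod.swap p)}\<inverse> \<subseteq> U"
    using QR by auto
  ultimately show "\<exists>V. mem V (ents X) \<and> V \<inter> V\<inverse> \<subseteq> U" by blast
next
  assume "\<exists>V. mem V (ents X) \<and> V \<inter> V\<inverse> \<subseteq> U"
  then obtain V where V: "mem V (ents X)" "V \<inter> V\<inverse> \<subseteq> U" by blast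
  have "prod.swap -` V\<inverse> = V" by auto
  then have "eventually (\<lambda>p. p \<in> V\<inverse>) (filtermap prod.swap (ents X))"
    using V(1) mem_filtermap[of "V\<inverse>" prod.swap "ents X"] by (simp add: mem_def)
  then show "mem U (ents (qsym X))"
    using V unfolding mem_def qsym_def qus.simps eventually_inf
    by (intro exI[of _ "\<lambda>p. p \<in> V"] exI[of _ "\<lambda>p. p \<in> V\<inverse>"]) auto
qed

lemma qsym_pts [simp]: "pts (qsym X) = pts X"
  by (simp add: qsym_def)

text \<open>The space \<open>qsym X\<close> carries the coarsest uniformity containing that of \<open>X\<close>.\<close>

lemma qunif_qsym: assumes "qunif X" shows "qunif (qsym X)"
  unfolding qunif_def
proof (intro conjI allI impI ballI)
  show "mem (pts (qsym X) \<times> pts (qsym X)) (ents (qsym X))"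
    using assms unfolding mem_qsym qunif_def by auto
next
  fix U x assume "mem U (ents (qsym X))" "x \<in> pts (qsym X)"
  then show "(x, x) \<in> U" using assms unfolding mem_qsym qunif_def by auto
next
  fix U assume "mem U (ents (qsym X))"
  then obtain W where W: "mem W (ents X)" "W \<inter> W\<inverse> \<subseteq> U" by (auto simp: mem_qsym)
  then obtain V where V: "mem V (ents X)" "V O V \<subseteq> W" using assms unfolding qunif_def by blast
  have "(V \<inter> V\<inverse>) O (V \<inter> V\<inverse>) \<subseteq> U" using V(2) W(2) by blast
  then show "\<exists>V. mem V (ents (qsym X)) \<and> V O V \<subseteq> U"
    using V(1) by (intro exI[of _ "V \<inter> V\<inverse>"]) (auto simp: mem_qsym)
qed

lemma qsym_symmetric: "mem U (ents (qsym X)) \<Longrightarrow> mem (U\<inverse>) (ents (qsym X))"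
  unfolding mem_qsym by blast

lemma qsym_contains: "mem U (ents X) \<Longrightarrow> mem U (ents (qsym X))"
  unfolding mem_qsym by blast

lemma qsym_coarsest:
  assumes "\<And>U. mem U (ents X) \<Longrightarrow> mem U E" "\<And>U. mem U E \<Longrightarrow> mem (U\<inverse>) E"
    and "mem U (ents (qsym X))"
  shows "mem U E"
proof -
  obtain V where "mem V (ents X)" "V \<inter> V\<inverse> \<subseteq> U" using assms(3) by (auto simp: mem_qsym)
  then show ?thesis using assms(1,2) mem_Int mem_mono by metis
qed

lemma separated_iff:
  assumes X: "qunif X"
  shows "separated_qus X \<longleftrightarrow>
    (\<forall>x \<in> pts X. \<forall>y \<in> pts X. (\<forall>U. mem U (ents X) \<longrightarrow> (x, y) \<in> U \<and> (y, x) \<in> U) \<longrightarrow> x = y)"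
    (is "_ \<longleftrightarrow> ?R")
proof
  assume H: "separated_qus X"
  show ?R
  proof (intro ballI impI, rule ccontr)
    fix x y
    assume xy: "x \<in> pts X" "y \<in> pts X" "x \<noteq> y"
      and U: "\<forall>U. mem U (ents X) \<longrightarrow> (x, y) \<in> U \<and> (y, x) \<in> U"
    then obtain G H where G: "openin (qtop (qsym X)) G" "x \<in> G" "y \<in> H" "disjnt G H"
      using H unfolding separated_qus_def Hausdorff_space_def by (metis qsym_pts topspace_qtop)
    then obtain W where "mem W (ents (qsym X))" "{y \<in> pts X. (x, y) \<in> W} \<subseteq> G"
      unfolding openin_qtop by auto
    then have "y \<in> G" using xy U unfolding mem_qsym by blast
    then show False using G by (auto simp: disjnt_iff)
  qed
next
  assume R: ?R
  show "separated_qus X"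
    unfolding separated_qus_def Hausdorff_space_def
  proof (intro allI impI)
    fix x y
    assume "x \<in> topspace (qtop (qsym X)) \<and> y \<in> topspace (qtop (qsym X)) \<and> x \<noteq> y"
    then have xy: "x \<in> pts X" "y \<in> pts X" "x \<noteq> y" by auto
    then obtain U0 where U0: "mem U0 (ents X)" "\<not> ((x, y) \<in> U0 \<and> (y, x) \<in> U0)"
      using R by blast
    obtain V0 where V0: "mem V0 (ents X)" "V0 O V0 \<subseteq> U0"
      using X U0(1) unfolding qunif_def by blast
    define V where "V = V0 \<inter> V0\<inverse>"
    have Vm: "mem V (ents (qsym X))" unfolding mem_qsym V_def using V0 by blast
    define N where "N z = {a \<in> pts X. \<exists>W. mem W (ents (qsym X)) \<and> {b \<in> pts X. (a, b) \<in> W} \<subseteq> {b. (z, b) \<in> V}}"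
      for z
    have op: "openin (qtop (qsym X)) (N z)" for z
      unfolding openin_qtop
    proof (intro conjI ballI)
      show "N z \<subseteq> pts (qsym X)" by (auto simp: N_def)
      fix a assume "a \<in> N z"
      then obtain W where W: "mem W (ents (qsym X))" "{b \<in> pts X. (a, b) \<in> W} \<subseteq> {b. (z, b) \<in> V}"
        unfolding N_def by blast
      obtain W' where W': "mem W' (ents (qsym X))" "W' O W' \<subseteq> W"
        using qunif_qsym[OF X] W(1) unfolding qunif_def by blast
      have "{y \<in> pts (qsym X). (a, y) \<in> W'} \<subseteq> N z"
      proof
        fix b assume b: "b \<in> {y \<in> pts (qsym X). (a, y) \<in> W'}"
        have "{c \<in> pts X. (b, c) \<in> W'} \<subseteq> {c. (z, c) \<in> V}"
          using b W'(2) W(2) by blast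
        then show "b \<in> N z" using b W'(1) unfolding N_def by auto
      qed
      then show "\<exists>U. mem U (ents (qsym X)) \<and> {y \<in> pts (qsym X). (a, y) \<in> U} \<subseteq> N z"
        using W'(1) by blast
    qed
    have self: "z \<in> N z" if "z \<in> pts X" for z
      using that Vm unfolding N_def by blast
    have "disjnt (N x) (N y)"
    proof -
      have False if a: "a \<in> N x" "a \<in> N y" for a
      proof -
        have "(b, a) \<in> V" if "a \<in> N b" for b
          using that qunif_qsym[OF X] unfolding N_def qunif_def by auto
        then have "(x, a) \<in> V" "(y, a) \<in> V" using a by auto
        then have "(x, y) \<in> V0 O V0" "(y, x) \<in> V0 O V0" unfolding V_def by auto
        then show False using U0(2) V0(2) by blast
      qed
      then show ?thesis by (auto simp: disjnt_iff)
    qed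
    then show "\<exists>U V. openin (qtop (qsym X)) U \<and> openin (qtop (qsym X)) V \<and> x \<in> U \<and> y \<in> V \<and> disjnt U V"
      using op self xy by blast
  qed
qed


subsection \<open>The completion\<close>

lemma mem_compl: "mem E (ents (compl X)) \<longleftrightarrow> (\<exists>U. mem U (ents X) \<and> star X U \<subseteq> E)"
proof -
  have "\<exists>W \<in> {U. mem U (ents X)}.
          principal (star X W) \<le> inf (principal (star X U)) (principal (star X V))"
    if "U \<in> {U. mem U (ents X)}" "V \<in> {U. mem U (ents X)}" for U V
    using that by (intro bexI[of _ "U \<inter> V"]) (auto simp: star_def mem_Int)
  moreover have "UNIV \<in> {U. mem U (ents X)}" by (simp add: mem_def)
  ultimately show ?thesis
    unfolding mem_def[of E] compl_def qus.simps
    by (subst eventually_INF_base) (auto simp: eventually_principal)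
qed

lemma pts_compl [simp]: "pts (compl X) = {F. cauchy_on X F}"
  by (simp add: compl_def)

lemma qunif_compl: assumes "qunif X" shows "qunif (compl X)"
  unfolding qunif_def
proof (intro conjI allI impI ballI)
  have "mem UNIV (ents X)" by (simp add: mem_def)
  then show "mem (pts (compl X) \<times> pts (compl X)) (ents (compl X))"
    unfolding mem_compl by (intro exI[of _ UNIV]) (auto simp: star_def)
next
  fix E F assume "mem E (ents (compl X))" "F \<in> pts (compl X)"
  then show "(F, F) \<in> E"
    unfolding mem_compl star_def cauchy_on_def pts_compl by blast
next
  fix E assume "mem E (ents (compl X))"
  then obtain U where U: "mem U (ents X)" "star X U \<subseteq> E" by (auto simp: mem_compl)
  then obtain V where V: "mem V (ents X)" "V O V \<subseteq> U" using assms unfolding qunif_def by blast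
  have "star X V O star X V \<subseteq> star X U"
  proof
    fix p assume "p \<in> star X V O star X V"
    then obtain F G H where p: "p = (F, H)" and "(F, G) \<in> star X V" "(G, H) \<in> star X V" by auto
    then obtain A B B' C where c: "cauchy_on X F" "cauchy_on X G" "cauchy_on X H"
        and *: "mem A F" "mem B G" "A \<times> B \<subseteq> V" "mem B' G" "mem C H" "B' \<times> C \<subseteq> V"
      unfolding star_def by blast
    have "B \<inter> B' \<noteq> {}"
      using c(2) mem_nonempty[OF mem_Int[OF *(2,4)]] by (simp add: cauchy_on_def)
    then obtain b where "b \<in> B" "b \<in> B'" by auto
    then have "A \<times> C \<subseteq> U" using * V(2) by blast
    then show "p \<in> star X U" using p c * unfolding star_def by blast
  qed
  then show "\<exists>D. mem D (ents (compl X)) \<and> D O D \<subseteq> E"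
    using U(2) V(1) by (intro exI[of _ "star X V"]) (auto simp: mem_compl)
qed

lemma qumap_compl_unit: assumes X: "qunif X" shows "qumap X (compl X) compl_unit"
proof -
  have c: "cauchy_on X (compl_unit x)" if "x \<in> pts X" for x
    using that X unfolding cauchy_on_def qunif_def compl_unit_def mem_def
    by (auto simp: eventually_principal principal_eq_bot_iff intro!: exI[of _ "{x}"])
  have "mem {(x, y). (compl_unit x, compl_unit y) \<in> E} (ents X)" if E: "mem E (ents (compl X))" for E
  proof -
    obtain U where U: "mem U (ents X)" "star X U \<subseteq> E" using E by (auto simp: mem_compl)
    have "(compl_unit x, compl_unit y) \<in> star X U"
      if "(x, y) \<in> U \<inter> pts X \<times> pts X" for x y
    proof -
      have "mem {x} (compl_unit x)" "mem {y} (compl_unit y)" "{x} \<times> {y} \<subseteq> U"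
        using that by (auto simp: compl_unit_def mem_def eventually_principal)
      then show ?thesis using that c unfolding star_def by blast
    qed
    then have "U \<inter> pts X \<times> pts X \<subseteq> {(x, y). (compl_unit x, compl_unit y) \<in> E}"
      using U(2) by auto
    moreover have "mem (U \<inter> pts X \<times> pts X) (ents X)"
      using U(1) X by (auto simp: qunif_def intro: mem_Int)
    ultimately show ?thesis by (rule mem_mono[rotated])
  qed
  then show ?thesis using c by (auto simp: qumap_iff)
qed

lemma mem_compl_map: "mem A (compl_map f F) \<longleftrightarrow> mem (f -` A) F"
  by (simp add: compl_map_def mem_filtermap)

lemma mem_compl_mult: "mem A (compl_mult XX) \<longleftrightarrow> mem {F. mem A F} XX"
proof -
  have "is_filter (\<lambda>P. eventually (\<lambda>F. eventually P F) XX)"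
  proof
    show "eventually (\<lambda>F. eventually (\<lambda>x. True) F) XX" by simp
  next
    fix P Q
    assume "eventually (\<lambda>F. eventually P F) XX" "eventually (\<lambda>F. eventually Q F) XX"
    then show "eventually (\<lambda>F. eventually (\<lambda>x. P x \<and> Q x) F) XX"
      by eventually_elim (rule eventually_conj)
  next
    fix P Q
    assume "\<forall>x. P x \<longrightarrow> Q x" "eventually (\<lambda>F. eventually P F) XX"
    then show "eventually (\<lambda>F. eventually Q F) XX"
      by (auto elim!: eventually_mono)
  qed
  then show ?thesis
    by (simp add: mem_def compl_mult_def eventually_Abs_filter)
qed


subsection \<open>The reflector\<close>

lemma equiv_sep_rel: assumes "qunif X" shows "equiv (pts X) (sep_rel X)"
proof (rule equivI)
  show "sep_rel X \<subseteq> pts X \<times> pts X" by (auto simp: sep_rel_def)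
  show "refl_on (pts X) (sep_rel X)"
    using assms by (auto simp: refl_on_def sep_rel_def qunif_def)
  show "sym (sep_rel X)" by (auto simp: sym_def sep_rel_def)
  show "trans (sep_rel X)"
  proof (rule transI)
    fix x y z assume *: "(x, y) \<in> sep_rel X" "(y, z) \<in> sep_rel X"
    have "(x, z) \<in> U \<and> (z, x) \<in> U" if "mem U (ents X)" for U
    proof -
      obtain V where V: "mem V (ents X)" "V O V \<subseteq> U"
        using assms \<open>mem U (ents X)\<close> unfolding qunif_def by blast
      then have "(x, y) \<in> V" "(y, x) \<in> V" "(y, z) \<in> V" "(z, y) \<in> V"
        using * unfolding sep_rel_def by simp_all
      then show ?thesis using V(2) by blast
    qed
    then show "(x, z) \<in> sep_rel X" using * by (auto simp: sep_rel_def)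
  qed
qed

lemma pts_sep [simp]: "pts (sep X) = sep_unit X ` pts X"
  by (auto simp: sep_def sep_unit_def quotient_def)

lemma sep_unit_eq:
  assumes "qunif X" "x \<in> pts X" "y \<in> pts X"
  shows "sep_unit X x = sep_unit X y \<longleftrightarrow> (x, y) \<in> sep_rel X"
  unfolding sep_unit_def using equiv_sep_rel[OF assms(1)] assms(2,3) by (simp add: eq_equiv_class_iff)

lemma mem_sep: "mem E (ents (sep X)) \<longleftrightarrow> mem {(x, y). (sep_unit X x, sep_unit X y) \<in> E} (ents X)"
  by (simp add: sep_def mem_filtermap vimage_def map_prod_def case_prod_unfold)

lemma qunif_sep: assumes X: "qunif X" shows "qunif (sep X)"
  unfolding qunif_def
proof (intro conjI allI impI ballI)
  have "mem (pts X \<times> pts X) (ents X)" using X by (simp add: qunif_def)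
  then show "mem (pts (sep X) \<times> pts (sep X)) (ents (sep X))"
    unfolding mem_sep by (rule mem_mono) auto
next
  fix E c assume "mem E (ents (sep X))" "c \<in> pts (sep X)"
  then show "(c, c) \<in> E" using X unfolding mem_sep qunif_def by auto
next
  fix E assume "mem E (ents (sep X))"
  then obtain W where W: "mem W (ents X)"
      "W O W \<subseteq> {(x, y). (sep_unit X x, sep_unit X y) \<in> E}"
    using X unfolding mem_sep qunif_def by blast
  obtain V where V: "mem V (ents X)" "V O V \<subseteq> W" using X W(1) unfolding qunif_def by blast
  have Vp: "mem (V \<inter> pts X \<times> pts X) (ents X)"
    using V(1) X by (auto simp: qunif_def intro: mem_Int)
  have VW: "(x, z) \<in> W" if "(x, y) \<in> V" "(y, z) \<in> V" for x y z using that V(2) by blast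
  have VW1: "(x, y) \<in> W" if "(x, y) \<in> V" "y \<in> pts X" for x y
    using that V(1) X VW[of x y y] unfolding qunif_def by blast
  let ?D = "map_prod (sep_unit X) (sep_unit X) ` (V \<inter> pts X \<times> pts X)"
  have "mem ?D (ents (sep X))"
    unfolding mem_sep using Vp by (rule mem_mono) force
  moreover have "?D O ?D \<subseteq> E"
  proof
    fix p assume "p \<in> ?D O ?D"
    then obtain x y y' z where p: "p = (sep_unit X x, sep_unit X z)"
      and m: "(x, y) \<in> V" "(y', z) \<in> V" "x \<in> pts X" "y \<in> pts X" "y' \<in> pts X" "z \<in> pts X"
      and e: "sep_unit X y = sep_unit X y'" by fastforce
    have "(y, y') \<in> V" using e m sep_unit_eq[OF X] V(1) by (auto simp: sep_rel_def)
    then have "(x, y') \<in> W" "(y', z) \<in> W" using m VW VW1 by blast+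
    then show "p \<in> E" using W(2) p by blast
  qed
  ultimately show "\<exists>D. mem D (ents (sep X)) \<and> D O D \<subseteq> E" by blast
qed

lemma separated_sep: assumes X: "qunif X" shows "separated_qus (sep X)"
  unfolding separated_iff[OF qunif_sep[OF X]]
proof (intro ballI impI)
  fix c d
  assume "c \<in> pts (sep X)" "d \<in> pts (sep X)"
    and E: "\<forall>E. mem E (ents (sep X)) \<longrightarrow> (c, d) \<in> E \<and> (d, c) \<in> E"
  then obtain x y where x: "x \<in> pts X" "c = sep_unit X x" and y: "y \<in> pts X" "d = sep_unit X y"
    by auto
  have "(x, y) \<in> U \<and> (y, x) \<in> U" if U: "mem U (ents X)" for U
  proof -
    obtain W where W: "mem W (ents X)" "W O W \<subseteq> U" using X U unfolding qunif_def by blast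
    obtain V where V: "mem V (ents X)" "V O V \<subseteq> W" using X W unfolding qunif_def by blast
    let ?V = "V \<inter> pts X \<times> pts X"
    let ?D = "map_prod (sep_unit X) (sep_unit X) ` ?V"
    have "mem ?V (ents X)" using V(1) X by (auto simp: qunif_def intro: mem_Int)
    then have "mem ?D (ents (sep X))" unfolding mem_sep by (rule mem_mono) force
    then have cd: "(c, d) \<in> ?D" "(d, c) \<in> ?D" using E by auto
    have key: "(a, b) \<in> U"
      if D: "(sep_unit X a, sep_unit X b) \<in> ?D" and pt: "a \<in> pts X" "b \<in> pts X" for a b
    proof -
      obtain a' b' where ab: "(a', b') \<in> V" "a' \<in> pts X" "b' \<in> pts X"
          "sep_unit X a = sep_unit X a'" "sep_unit X b' = sep_unit X b" using D by auto
      then have "(a, a') \<in> V" "(b', b) \<in> V" "(b, b) \<in> V"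
        using pt sep_unit_eq[OF X] V(1) X by (auto simp: sep_rel_def qunif_def)
      then have "(a, b') \<in> W" "(b', b) \<in> W" using V(2) ab(1) by blast+
      then show ?thesis using W(2) by blast
    qed
    show ?thesis
      using key[of x y] key[of y x] cd x y by simp
  qed
  then show "c = d" using x y sep_unit_eq[OF X] by (auto simp: sep_rel_def)
qed

lemma qumap_sep_unit: "qumap X (sep X) (sep_unit X)"
  by (auto simp: qumap_iff mem_sep)

lemma qumap_sep_rel:
  assumes "qunif X" "qumap X Y f" "(x, y) \<in> sep_rel X"
  shows "(f x, f y) \<in> sep_rel Y"
  using assms unfolding sep_rel_def qumap_iff by (auto simp: Pi_iff)

theorem sep_universal:
  fixes X :: "'a qus" and Z :: "'c qus"
  assumes X: "qunif X" and Z: "qunif Z" "separated_qus Z" and f: "qumap X Z f"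
  shows "\<exists>g. qumap (sep X) Z g \<and> (\<forall>x \<in> pts X. g (sep_unit X x) = f x) \<and>
           (\<forall>h. qumap (sep X) Z h \<and> (\<forall>x \<in> pts X. h (sep_unit X x) = f x)
              \<longrightarrow> (\<forall>c \<in> pts (sep X). h c = g c))"
proof -
  define g where "g c = f (SOME x. x \<in> pts X \<and> sep_unit X x = c)" for c
  have g: "g (sep_unit X x) = f x" if x: "x \<in> pts X" for x
  proof -
    define y where "y = (SOME y. y \<in> pts X \<and> sep_unit X y = sep_unit X x)"
    have y: "y \<in> pts X \<and> sep_unit X y = sep_unit X x"
      unfolding y_def by (rule someI[of _ x]) (use x in simp)
    then have "(f y, f x) \<in> sep_rel Z"
      using x sep_unit_eq[OF X] qumap_sep_rel[OF X f] by blast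
    then have "f y = f x" using Z separated_iff unfolding sep_rel_def by blast
    then show ?thesis by (simp add: g_def y_def)
  qed
  have "mem {(c, d). (g c, g d) \<in> V} (ents (sep X))" if "mem V (ents Z)" for V
  proof -
    have "mem ({(x, y). (f x, f y) \<in> V} \<inter> pts X \<times> pts X) (ents X)"
      using that f X by (auto simp: qumap_iff qunif_def intro: mem_Int)
    then show ?thesis unfolding mem_sep by (rule mem_mono) (auto simp: g)
  qed
  then have "qumap (sep X) Z g"
    using f g by (auto simp: qumap_iff Pi_iff)
  then show ?thesis using g by (intro exI[of _ g]) auto
qed

lemma sep_map_unit:
  assumes X: "qunif X" and Y: "qunif Y" and f: "qumap X Y f" and x: "x \<in> pts X"
  shows "sep_map Y f (sep_unit X x) = sep_unit Y (f x)"
proof -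
  have x': "x \<in> sep_unit X x"
    using equiv_sep_rel[OF X] x unfolding sep_unit_def by (rule equiv_class_self)
  have eq: "sep_unit Y (f y) = sep_unit Y (f x)" if "y \<in> sep_unit X x" for y
  proof -
    have "(x, y) \<in> sep_rel X" using that by (simp add: sep_unit_def)
    from qumap_sep_rel[OF X f this] have "sep_unit Y (f x) = sep_unit Y (f y)"
      unfolding sep_unit_def by (rule equiv_class_eq[OF equiv_sep_rel[OF Y]])
    then show ?thesis by simp
  qed
  from x' have "sep_unit X x \<noteq> {}" by blast
  then show ?thesis
    unfolding sep_map_def by (rule the_elem_image_unique) (rule eq)
qed

lemma qumap_sep_map:
  assumes X: "qunif X" and Y: "qunif Y" and f: "qumap X Y f"
  shows "qumap (sep X) (sep Y) (sep_map Y f)"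
proof -
  have "mem {(c, d). (sep_map Y f c, sep_map Y f d) \<in> V} (ents (sep X))"
    if "mem V (ents (sep Y))" for V
  proof -
    have "mem ({(x, y). (sep_unit Y (f x), sep_unit Y (f y)) \<in> V} \<inter> pts X \<times> pts X) (ents X)"
      using that f X unfolding mem_sep qumap_iff qunif_def by (auto intro!: mem_Int)
    then show ?thesis unfolding mem_sep by (rule mem_mono) (auto simp: sep_map_unit[OF X Y f])
  qed
  then show ?thesis
    using f by (auto simp: qumap_iff Pi_iff sep_map_unit[OF X Y f])
qed

lemma sep_map_unique:
  assumes X: "qunif X" and Y: "qunif Y" and f: "qumap X Y f"
    and h: "\<And>x. x \<in> pts X \<Longrightarrow> h (sep_unit X x) = sep_unit Y (f x)" and c: "c \<in> pts (sep X)"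
  shows "h c = sep_map Y f c"
  using c h sep_map_unit[OF X Y f] by auto

end

theory Submission
  imports Defs
begin

text \<open>
  The argument is driven by the symmetrization \<open>qsym\<close>, in whose topology both density and
  convergence are meant.

  Epimorphism: a Cauchy filter \<open>F\<close> has, for each entourage \<open>U\<close>, a member \<open>A\<close> with
  \<open>A \<times> A \<subseteq> U\<close>, and the principal filter of any point of \<open>A\<close> is then \<open>star X U\<close>-close to \<open>F\<close> in
  both directions (\<open>compl_unit_dense\<close>). So the points of \<open>X\<close> are dense in the completion, and
  their classes are dense in its reflection. Two morphisms into a separated space which agree on
  a dense set agree everywhere (\<open>dense_maps_agree\<close>).

  Completeness: a Cauchy filter \<open>XX\<close> of Cauchy filters converges to \<open>compl_mult XX\<close>. The heart of
  this is \<open>cauchy_compl_common_small_set\<close>: one \<open>U\<close>-small set belongs to all of the filters in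
  some member of \<open>XX\<close>. It shows at once that \<open>compl_mult XX\<close> is Cauchy and that the
  filters in that member of \<open>XX\<close> are \<open>star X U\<close>-close to it. Finally, completeness passes to the
  reflection (\<open>complete_sep\<close>), since up to refinement the entourages of a space are the preimages
  of the entourages of its reflection, so Cauchy filters can be pulled back along the unit.
\<close>

section \<open>Density and epimorphisms\<close>

text \<open>
  If \<open>g\<close> and \<open>h\<close> agree at a point \<open>d\<close> close to \<open>y\<close>, then \<open>g y\<close> and \<open>h y\<close> are linked through the
  common value at \<open>d\<close>; so no entourage of \<open>Z\<close> tells them apart. Only density at \<open>y\<close> enters.
\<close>

lemma dense_maps_agree:
  assumes Z: "qunif Z" "separated_qus Z" and g: "qumap Y Z g" and h: "qumap Y Z h"
    and y: "y \<in> pts Y"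
    and dense: "\<And>U. mem U (ents Y) \<Longrightarrow> \<exists>d. (y, d) \<in> U \<and> (d, y) \<in> U \<and> g d = h d"
  shows "g y = h y"
proof -
  have "(g y, h y) \<in> W \<and> (h y, g y) \<in> W" if W: "mem W (ents Z)" for W
  proof -
    obtain V where V: "mem V (ents Z)" "V O V \<subseteq> W" using Z(1) W unfolding qunif_def by blast
    let ?U = "{(a, b). (g a, g b) \<in> V} \<inter> {(a, b). (h a, h b) \<in> V}"
    have "mem {(a, b). (g a, g b) \<in> V} (ents Y)" "mem {(a, b). (h a, h b) \<in> V} (ents Y)"
      using g h V(1) unfolding qumap_iff by blast+
    then have "mem ?U (ents Y)" by (rule mem_Int)
    from dense[OF this] obtain d where "(y, d) \<in> ?U" "(d, y) \<in> ?U" and gh: "g d = h d"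
      by (elim exE conjE)
    then have "(g y, g d) \<in> V" "(g d, h y) \<in> V" "(h y, g d) \<in> V" "(g d, g y) \<in> V"
      by (simp_all add: gh)
    then show ?thesis using V(2) by blast
  qed
  moreover have "g y \<in> pts Z" "h y \<in> pts Z" using g h y by (auto simp: qumap_def)
  ultimately show ?thesis using Z(2) unfolding separated_iff[OF Z(1)] by blast
qed

lemma compl_unit_dense:
  assumes X: "qunif X" and F: "cauchy_on X F" and U: "mem U (ents X)"
  obtains a where "a \<in> pts X" "(F, compl_unit a) \<in> star X U" "(compl_unit a, F) \<in> star X U"
proof -
  obtain A where A: "mem A F" "A \<times> A \<subseteq> U" using F U unfolding cauchy_on_def by blast
  have "mem (A \<inter> pts X) F" "F \<noteq> bot" using F A(1) by (auto simp: cauchy_on_def intro: mem_Int)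
  then have "A \<inter> pts X \<noteq> {}" by (rule mem_nonempty)
  then obtain a where a: "a \<in> A" "a \<in> pts X" by blast
  have "cauchy_on X (compl_unit a)"
    using qumap_compl_unit[OF X] a(2) by (auto simp: qumap_def)
  moreover have "mem A (compl_unit a)"
    using a(1) by (simp add: mem_def compl_unit_def eventually_principal)
  ultimately have "(F, compl_unit a) \<in> star X U" "(compl_unit a, F) \<in> star X U"
    using F A unfolding star_def by blast+
  with a(2) show ?thesis by (rule that)
qed

text \<open>
  Entourages of the reflection are tested on representatives, so the density of the points in the
  completion carries over to their classes.
\<close>

lemma sep_compl_unit_epi:
  fixes X :: "'a qus"
  assumes X: "qunif X"
  shows "epi_qunif0 TYPE('c) (sep X) (sep (compl X)) (sep_map (compl X) compl_unit)"
  unfolding epi_qunif0_def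
proof (intro conjI allI impI)
  note C = qunif_compl[OF X] and unit = qumap_compl_unit[OF X]
  show "qunif (sep X)" "separated_qus (sep X)" "qunif (sep (compl X))" "separated_qus (sep (compl X))"
    using X C by (simp_all add: qunif_sep separated_sep)
  show "qumap (sep X) (sep (compl X)) (sep_map (compl X) compl_unit)"
    using X C unit by (rule qumap_sep_map)
  fix Z :: "'c qus" and g h
  assume H: "qunif Z \<and> separated_qus Z \<and> qumap (sep (compl X)) Z g \<and> qumap (sep (compl X)) Z h \<and>
      (\<forall>c \<in> pts (sep X). g (sep_map (compl X) compl_unit c) = h (sep_map (compl X) compl_unit c))"
  then have Z: "qunif Z" "separated_qus Z"
    and g: "qumap (sep (compl X)) Z g" and h: "qumap (sep (compl X)) Z h"
    and agree: "\<And>c. c \<in> pts (sep X) \<Longrightarrow>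
      g (sep_map (compl X) compl_unit c) = h (sep_map (compl X) compl_unit c)"
    by blast+
  let ?q = "sep_unit (compl X)"
  have eq: "g (?q (compl_unit a)) = h (?q (compl_unit a))" if "a \<in> pts X" for a
  proof -
    have "sep_map (compl X) compl_unit (sep_unit X a) = ?q (compl_unit a)"
      using X C unit that by (rule sep_map_unit)
    moreover have "sep_unit X a \<in> pts (sep X)" using that by simp
    ultimately show ?thesis using agree[of "sep_unit X a"] by simp
  qed
  show "\<forall>y \<in> pts (sep (compl X)). g y = h y"
  proof
    fix y assume y: "y \<in> pts (sep (compl X))"
    then obtain F where F: "cauchy_on X F" "y = ?q F" by auto
    show "g y = h y"
    proof (rule dense_maps_agree[of Z "sep (compl X)" g h y])
      show "qunif Z" "separated_qus Z" by (rule Z)+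
      show "qumap (sep (compl X)) Z g" by (rule g)
      show "qumap (sep (compl X)) Z h" by (rule h)
      show "y \<in> pts (sep (compl X))" by (rule y)
      fix E assume "mem E (ents (sep (compl X)))"
      then obtain U where U: "mem U (ents X)" "star X U \<subseteq> {(G, H). (?q G, ?q H) \<in> E}"
        unfolding mem_sep mem_compl by blast
      obtain a where a: "a \<in> pts X" "(F, compl_unit a) \<in> star X U" "(compl_unit a, F) \<in> star X U"
        using X F(1) U(1) by (rule compl_unit_dense)
      then have "(?q F, ?q (compl_unit a)) \<in> E" "(?q (compl_unit a), ?q F) \<in> E"
        using U(2) by blast+
      then show "\<exists>d. (y, d) \<in> E \<and> (d, y) \<in> E \<and> g d = h d"
        using eq[OF a(1)] unfolding F(2) by (intro exI[of _ "?q (compl_unit a)"] conjI)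
    qed
  qed
qed

section \<open>Completeness of the space of Cauchy filters\<close>

text \<open>
  The neighbourhoods in the symmetrized topology are generated by closeness in both directions.
\<close>

lemma limitin_qsymI:
  assumes x: "x \<in> pts Y" and F: "mem (pts Y) F"
    and near: "\<And>U. mem U (ents Y) \<Longrightarrow> mem {y. (x, y) \<in> U \<and> (y, x) \<in> U} F"
  shows "limitin (qtop (qsym Y)) (\<lambda>y. y) x F"
  unfolding limitin_def
proof (intro conjI allI impI)
  show "x \<in> topspace (qtop (qsym Y))" using x by simp
  fix G assume "openin (qtop (qsym Y)) G \<and> x \<in> G"
  then obtain W where "mem W (ents (qsym Y))" and W: "{y \<in> pts Y. (x, y) \<in> W} \<subseteq> G"
    unfolding openin_qtop by auto
  then obtain V where V: "mem V (ents Y)" "V \<inter> V\<inverse> \<subseteq> W" unfolding mem_qsym by blast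
  have "mem (pts Y \<inter> {y. (x, y) \<in> V \<and> (y, x) \<in> V}) F"
    using F near[OF V(1)] by (rule mem_Int)
  then have "mem G F" by (rule mem_mono) (use V(2) W in blast)
  then show "eventually (\<lambda>y. y \<in> G) F" by (simp add: mem_def)
qed

text \<open>
  Let the filters in \<open>AA\<close> be pairwise \<open>V\<close>-close, with \<open>V O V \<subseteq> U\<close>, and fix one of them, \<open>F0\<close>.
  Each \<open>F \<in> AA\<close> has a member \<open>S\<close> with \<open>S \<times> B \<subseteq> V\<close> and \<open>C \<times> S \<subseteq> V\<close> for some members \<open>B\<close> and \<open>C\<close> of
  \<open>F0\<close>. The union of all such sets \<open>S\<close> is as required: two members of \<open>F0\<close> always meet,
  and a common point links any two points of the union.
\<close>

lemma cauchy_compl_common_small_set: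
  assumes X: "qunif X" and XX: "cauchy_on (compl X) XX" and U: "mem U (ents X)"
  obtains A where "mem {F. cauchy_on X F \<and> mem A F} XX" "A \<times> A \<subseteq> U"
proof -
  obtain V where V: "mem V (ents X)" "V O V \<subseteq> U" using X U unfolding qunif_def by blast
  have "mem (star X V) (ents (compl X))" using V(1) by (auto simp: mem_compl)
  then obtain AA where AA: "mem AA XX" "AA \<times> AA \<subseteq> star X V"
    using XX unfolding cauchy_on_def by blast
  obtain F0 where F0: "F0 \<in> AA" using XX mem_nonempty[OF AA(1)] unfolding cauchy_on_def by blast
  then have F0_proper: "F0 \<noteq> bot" using AA(2) unfolding star_def cauchy_on_def by blast
  let ?small = "\<lambda>S. \<exists>B C. mem B F0 \<and> mem C F0 \<and> S \<times> B \<subseteq> V \<and> C \<times> S \<subseteq> V"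
  let ?A = "\<Union> {S. ?small S}"
  have "mem ?A F" if F: "F \<in> AA" for F
  proof -
    have "(F, F0) \<in> star X V" "(F0, F) \<in> star X V" using AA(2) F F0 by auto
    then obtain S B C T where *: "mem S F" "mem B F0" "S \<times> B \<subseteq> V" "mem C F0" "mem T F" "C \<times> T \<subseteq> V"
      unfolding star_def by blast
    have "mem (S \<inter> T) F" using *(1,5) by (rule mem_Int)
    moreover have "?small (S \<inter> T)" using * by blast
    ultimately show ?thesis using mem_mono[of "S \<inter> T" F ?A] by blast
  qed
  moreover have "cauchy_on X F" if "F \<in> AA" for F using AA(2) that unfolding star_def by blast
  ultimately have "AA \<subseteq> {F. cauchy_on X F \<and> mem ?A F}" by auto
  with AA(1) have "mem {F. cauchy_on X F \<and> mem ?A F} XX" by (rule mem_mono)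
  moreover have "?A \<times> ?A \<subseteq> U"
  proof
    fix p assume "p \<in> ?A \<times> ?A"
    then obtain x y S T B C where p: "p = (x, y)" "x \<in> S" "y \<in> T"
        and *: "mem B F0" "S \<times> B \<subseteq> V" "mem C F0" "C \<times> T \<subseteq> V" by blast
    obtain b where "b \<in> B" "b \<in> C" using mem_nonempty[OF mem_Int[OF *(1,3)] F0_proper] by blast
    then have "(x, b) \<in> V" "(b, y) \<in> V" using p * by auto
    then show "p \<in> U" using V(2) p(1) by blast
  qed
  ultimately show ?thesis by (rule that)
qed

lemma cauchy_compl_mult:
  assumes X: "qunif X" and XX: "cauchy_on (compl X) XX"
  shows "cauchy_on X (compl_mult XX)"
  unfolding cauchy_on_def
proof (intro conjI allI impI)
  have pts: "mem {F. cauchy_on X F} XX" and proper: "XX \<noteq> bot"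
    using XX by (simp_all add: cauchy_on_def[of "compl X"])
  show "compl_mult XX \<noteq> bot"
  proof
    assume "compl_mult XX = bot"
    then have "mem {} (compl_mult XX)" by (simp add: mem_def)
    then have "mem {F. mem {} F} XX" by (simp only: mem_compl_mult)
    then have "{F. cauchy_on X F} \<inter> {F. mem {} F} \<noteq> {}"
      using mem_nonempty[OF mem_Int[OF pts] proper] by simp
    then obtain F where "cauchy_on X F" "mem {} F" by blast
    then show False using mem_nonempty[of "{}" F] by (simp add: cauchy_on_def)
  qed
  show "mem (pts X) (compl_mult XX)"
    unfolding mem_compl_mult using pts by (rule mem_mono) (simp add: cauchy_on_def subset_iff)
  fix U assume "mem U (ents X)"
  with X XX obtain A where A: "mem {F. cauchy_on X F \<and> mem A F} XX" "A \<times> A \<subseteq> U"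
    by (rule cauchy_compl_common_small_set)
  from A(1) have "mem A (compl_mult XX)" unfolding mem_compl_mult by (rule mem_mono) blast
  with A(2) show "\<exists>A. mem A (compl_mult XX) \<and> A \<times> A \<subseteq> U" by blast
qed

lemma complete_compl: assumes X: "qunif X" shows "complete_qus (compl X)"
  unfolding complete_qus_def
proof (intro allI impI exI)
  fix XX assume XX: "cauchy_on (compl X) XX"
  let ?M = "compl_mult XX"
  have M: "cauchy_on X ?M" using X XX by (rule cauchy_compl_mult)
  show "limitin (qtop (qsym (compl X))) (\<lambda>y. y) ?M XX"
  proof (rule limitin_qsymI)
    show "?M \<in> pts (compl X)" using M by simp
    show "mem (pts (compl X)) XX" using XX by (simp add: cauchy_on_def)
    fix E assume "mem E (ents (compl X))"
    then obtain U where U: "mem U (ents X)" "star X U \<subseteq> E" by (auto simp: mem_compl)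
    obtain A where A: "mem {F. cauchy_on X F \<and> mem A F} XX" "A \<times> A \<subseteq> U"
      using X XX U(1) by (rule cauchy_compl_common_small_set)
    from A(1) have "mem A ?M" unfolding mem_compl_mult by (rule mem_mono) blast
    then have "{F. cauchy_on X F \<and> mem A F} \<subseteq> {F. (?M, F) \<in> star X U \<and> (F, ?M) \<in> star X U}"
      using A(2) M unfolding star_def by blast
    also have "\<dots> \<subseteq> {F. (?M, F) \<in> E \<and> (F, ?M) \<in> E}" using U(2) by blast
    finally show "mem {F. (?M, F) \<in> E \<and> (F, ?M) \<in> E} XX" using A(1) by (rule mem_mono[rotated])
  qed
qed

section \<open>Completeness of the reflection\<close>

text \<open>
  This is the sense in which a space carries the initial quasi-uniformity of its reflection. The
  image \<open>D\<close> of an entourage \<open>V\<close> only relates classes having \<open>V\<close>-close representatives; passing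
  to given representatives costs two more steps through \<open>V\<close>, hence two refinements of \<open>U\<close>.
\<close>

lemma sep_initial:
  assumes X: "qunif X" and U: "mem U (ents X)"
  obtains D where "mem D (ents (sep X))"
    "{(a, b) \<in> pts X \<times> pts X. (sep_unit X a, sep_unit X b) \<in> D} \<subseteq> U"
proof -
  obtain W where W: "mem W (ents X)" "W O W \<subseteq> U" using X U unfolding qunif_def by blast
  obtain V where V: "mem V (ents X)" "V O V \<subseteq> W" using X W unfolding qunif_def by blast
  let ?V = "V \<inter> pts X \<times> pts X"
  define D where "D = map_prod (sep_unit X) (sep_unit X) ` ?V"
  have "mem ?V (ents X)" using V(1) X by (auto simp: qunif_def intro: mem_Int)
  then have D: "mem D (ents (sep X))" unfolding mem_sep D_def by (rule mem_mono) force
  have small: "(a, b) \<in> U"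
    if pt: "a \<in> pts X" "b \<in> pts X" and D: "(sep_unit X a, sep_unit X b) \<in> D" for a b
  proof -
    obtain a' b' where ab: "(a', b') \<in> V" "a' \<in> pts X" "b' \<in> pts X"
        "sep_unit X a = sep_unit X a'" "sep_unit X b' = sep_unit X b" using D unfolding D_def by auto
    then have "(a, a') \<in> V" "(b', b) \<in> V" "(b, b) \<in> V"
      using pt sep_unit_eq[OF X] V(1) X by (auto simp: sep_rel_def qunif_def)
    then have "(a, b') \<in> W" "(b', b) \<in> W" using V(2) ab(1) by blast+
    then show ?thesis using W(2) by blast
  qed
  have "{(a, b) \<in> pts X \<times> pts X. (sep_unit X a, sep_unit X b) \<in> D} \<subseteq> U"
    using small by blast
  with D show ?thesis by (rule that)
qed

text \<open>
  The members of the filter used to lift a Cauchy filter from the reflection to the space. The meet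
  with \<open>principal (pts X)\<close> is there because \<open>sep_unit X\<close> is also defined off \<open>pts X\<close>.
\<close>

lemma mem_sep_pullback:
  "mem A (inf (filtercomap (sep_unit X) F) (principal (pts X))) \<longleftrightarrow>
     (\<exists>C. mem C F \<and> {a \<in> pts X. sep_unit X a \<in> C} \<subseteq> A)"
  (is "?L \<longleftrightarrow> ?R")
proof
  assume ?L
  then obtain P where "eventually P F" "\<forall>a. P (sep_unit X a) \<longrightarrow> a \<in> pts X \<longrightarrow> a \<in> A"
    unfolding mem_def eventually_inf_principal eventually_filtercomap by blast
  then show ?R by (intro exI[of _ "Collect P"]) (auto simp: mem_def)
next
  assume ?R
  then show ?L unfolding mem_def eventually_inf_principal eventually_filtercomap by blast
qed

lemma openin_sep_vimage:
  assumes "openin (qtop (qsym (sep X))) G"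
  shows "openin (qtop (qsym X)) {a \<in> pts X. sep_unit X a \<in> G}"
  unfolding openin_qtop
proof (intro conjI ballI)
  fix a assume a: "a \<in> {a \<in> pts X. sep_unit X a \<in> G}"
  with assms obtain W where "mem W (ents (qsym (sep X)))"
      and W: "{c \<in> pts (sep X). (sep_unit X a, c) \<in> W} \<subseteq> G"
    unfolding openin_qtop by auto
  then obtain V where V: "mem V (ents (sep X))" "V \<inter> V\<inverse> \<subseteq> W" unfolding mem_qsym by blast
  let ?U = "{(a, b). (sep_unit X a, sep_unit X b) \<in> V}"
  have "mem (?U \<inter> ?U\<inverse>) (ents (qsym X))" using V(1) unfolding mem_qsym mem_sep by blast
  moreover have "{b \<in> pts (qsym X). (a, b) \<in> ?U \<inter> ?U\<inverse>} \<subseteq> {a \<in> pts X. sep_unit X a \<in> G}"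
    using V(2) W by auto
  ultimately show "\<exists>U. mem U (ents (qsym X)) \<and>
      {b \<in> pts (qsym X). (a, b) \<in> U} \<subseteq> {a \<in> pts X. sep_unit X a \<in> G}" by blast
qed auto

lemma complete_sep:
  assumes X: "qunif X" and complete: "complete_qus X"
  shows "complete_qus (sep X)"
  unfolding complete_qus_def
proof (intro allI impI)
  fix F assume F: "cauchy_on (sep X) F"
  define F' where "F' = inf (filtercomap (sep_unit X) F) (principal (pts X))"
  note mem_F' = mem_sep_pullback[of _ X F, folded F'_def]
  have F_pts: "mem (pts (sep X)) F" and proper: "F \<noteq> bot" using F by (auto simp: cauchy_on_def)
  have "cauchy_on X F'"
    unfolding cauchy_on_def
  proof (intro conjI allI impI)
    \<comment> \<open>The lifted filter is proper since every point of the reflection is a class of points.\<close>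
    show "F' \<noteq> bot"
    proof
      assume "F' = bot"
      then have "mem {} F'" by (simp add: mem_def)
      then obtain C where C: "mem C F" "{a \<in> pts X. sep_unit X a \<in> C} = {}"
        unfolding mem_F' by blast
      have "pts (sep X) \<inter> C \<noteq> {}" using mem_nonempty[OF mem_Int[OF F_pts C(1)] proper] .
      then show False using C(2) by auto
    qed
    show "mem (pts X) F'" unfolding mem_F' using F_pts by blast
    fix U assume "mem U (ents X)"
    with X obtain D where D: "mem D (ents (sep X))"
      "{(a, b) \<in> pts X \<times> pts X. (sep_unit X a, sep_unit X b) \<in> D} \<subseteq> U"
      by (rule sep_initial)
    then obtain C where C: "mem C F" "C \<times> C \<subseteq> D" using F unfolding cauchy_on_def by blast
    let ?A = "{a \<in> pts X. sep_unit X a \<in> C}"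
    have "mem ?A F'" unfolding mem_F' using C(1) by blast
    moreover have "?A \<times> ?A \<subseteq> U" using C(2) D(2) by auto
    ultimately show "\<exists>A. mem A F' \<and> A \<times> A \<subseteq> U" by blast
  qed
  with complete obtain x where x: "limitin (qtop (qsym X)) (\<lambda>y. y) x F'"
    unfolding complete_qus_def by blast
  then have x_pts: "x \<in> pts X" by (auto simp: limitin_def)
  have "limitin (qtop (qsym (sep X))) (\<lambda>y. y) (sep_unit X x) F"
    unfolding limitin_def
  proof (intro conjI allI impI)
    show "sep_unit X x \<in> topspace (qtop (qsym (sep X)))" using x_pts by simp
    fix G assume G: "openin (qtop (qsym (sep X))) G \<and> sep_unit X x \<in> G"
    then have "openin (qtop (qsym X)) {a \<in> pts X. sep_unit X a \<in> G}"
        "x \<in> {a \<in> pts X. sep_unit X a \<in> G}"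
      using openin_sep_vimage x_pts by auto
    with x have "mem {a \<in> pts X. sep_unit X a \<in> G} F'"
      unfolding limitin_def mem_def by blast
    then obtain C where C: "mem C F"
        "{a \<in> pts X. sep_unit X a \<in> C} \<subseteq> {a \<in> pts X. sep_unit X a \<in> G}"
      unfolding mem_F' by blast
    have "mem (pts (sep X) \<inter> C) F" using F_pts C(1) by (rule mem_Int)
    then have "mem G F" by (rule mem_mono) (use C(2) in auto)
    then show "eventually (\<lambda>y. y \<in> G) F" by (simp add: mem_def)
  qed
  then show "\<exists>x. limitin (qtop (qsym (sep X))) (\<lambda>y. y) x F" by blast
qed

theorem lemma39:
  fixes X :: "'a qus"
  assumes "qunif X"
  shows "epi_qunif0 TYPE('c) (sep X) (sep (compl X)) (sep_map (compl X) compl_unit) \<and>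
    qunif (sep (compl X)) \<and> separated_qus (sep (compl X)) \<and> complete_qus (sep (compl X))"
  using sep_compl_unit_epi[OF assms] qunif_compl[OF assms] complete_compl[OF assms]
  by (simp add: qunif_sep separated_sep complete_sep)

end
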